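(* Let $(X,Y)$ be a random vector with marginal distributions $F,G$ and let $\Theta$ be a random variable with distribution $B$ such that $B(0-)=0$ and $B(0)<1$. Suppose that $\Theta$ and $(X,Y)$ are independent, that for every $c>0$ $$\mathbf{P}[\Theta>c\,(x\wedge y)]=o\big(\mathbf{P}[\Theta X>x,\ \Theta Y>y]\big),\qquad x\wedge y\to\infty,$$ and that $(X,Y)\in\mathcal{D}^{(2)}$. Then $(\Theta X,\Theta Y)\in\mathcal{D}^{(2)}$.
   Context: $x\wedge y=\min\{x,y\}$; $f(x,y)=o(g(x,y))$ as $x\wedge y\to\infty$ means $\lim_{x\wedge y\to\infty}f(x,y)/g(x,y)=0$. For a distribution $F$, $\overline F=1-F$; $F$ and $G$ satisfy $\overline F(x)>0$, $\overline G(x)>0$ for all $x\ge0$. $F\in\mathcal{D}$ (dominatedly varying) if $\limsup_{x\to\infty}\overline F(bx)/\overline F(x)<\infty$ for some (equivalently all) $b\in(0,1)$. A random pair $(X,Y)$ with marginal distributions $F,G$ belongs to $\mathcal{D}^{(2)}$ if $F\in\mathcal{D}$, $G\in\mathcal{D}$ and $\limsup_{x\wedge y\to\infty}\mathbf{P}[X>b_1x,Y>b_2y]/\mathbf{P}[X>x,Y>y]<\infty$ for some (equivalently all) $(b_1,b_2)\in(0,1)^2$ (joint tails in denominators are implicitly positive). The distribution $B$ is allowed to have support bounded from above. *)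

theory Defs
  imports "HOL-Probability.Probability" "HOL-Library.Landau_Symbols"
begin

(* The filter of the limit "x \<and> y tends to infinity". *)
definition min_at_top :: "(real \<times> real) filter" where
  "min_at_top = filtercomap (\<lambda>(x, y). min x y) at_top"

definition tail :: "real measure \<Rightarrow> real \<Rightarrow> real" where
  "tail F x = 1 - cdf F x"

definition joint_tail :: "'a measure \<Rightarrow> ('a \<Rightarrow> real) \<Rightarrow> ('a \<Rightarrow> real) \<Rightarrow> real \<Rightarrow> real \<Rightarrow> real" where
  "joint_tail M X Y x y = \<P>(\<omega> in M. X \<omega> > x \<and> Y \<omega> > y)"

(* In the next two definitions positivity of the tails has to be part of the class:
   it is implicit in the quotients on paper, whereas a / 0 = 0 in HOL.
   The upper limits are taken in the extended reals, so that finiteness is meaningful. *)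

definition dominatedly_varying :: "real measure \<Rightarrow> bool" where
  "dominatedly_varying F \<longleftrightarrow>
     (\<forall>x\<ge>0. tail F x > 0) \<and>
     (\<exists>b\<in>{0<..<1}. Limsup at_top (\<lambda>x. ereal (tail F (b * x) / tail F x)) < \<infinity>)"

definition jointly_dominatedly_varying ::
    "'a measure \<Rightarrow> ('a \<Rightarrow> real) \<Rightarrow> ('a \<Rightarrow> real) \<Rightarrow> bool" where
  "jointly_dominatedly_varying M X Y \<longleftrightarrow>
     dominatedly_varying (distr M borel X) \<and>
     dominatedly_varying (distr M borel Y) \<and>
     (\<forall>x\<ge>0. \<forall>y\<ge>0. joint_tail M X Y x y > 0) \<and>
     (\<exists>b1\<in>{0<..<1}. \<exists>b2\<in>{0<..<1}.
        Limsup min_at_top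
          (\<lambda>(x, y). ereal (joint_tail M X Y (b1 * x) (b2 * y) / joint_tail M X Y x y)) < \<infinity>)"

(* The library's indep_var needs both variables to have the same value type,
   so independence is stated for the generated sigma-algebras. *)
definition indep_of_pair ::
    "'a measure \<Rightarrow> ('a \<Rightarrow> real) \<Rightarrow> ('a \<Rightarrow> real \<times> real) \<Rightarrow> bool" where
  "indep_of_pair M T Z \<longleftrightarrow>
     prob_space.indep_set M
       (sets (vimage_algebra (space M) T borel))
       (sets (vimage_algebra (space M) Z borel))"

end

theory Submission
  imports Defs
begin

text \<open>
  Fix \<open>x, y\<close> and condition on \<open>\<Theta> = t\<close>: the event \<open>\<Theta> X > x, \<Theta> Y > y\<close> becomes
  \<open>X > x / t, Y > y / t\<close>. Dominated variation of \<open>(X, Y)\<close> says that lowering the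
  thresholds from \<open>(x, y)\<close> to \<open>(b1 x, b2 y)\<close> costs at most a factor \<open>K\<close>, provided that both
  thresholds exceed some \<open>R > 0\<close>. The conditioned thresholds do so as long as
  \<open>t \<le> min x y / R\<close>. Integrating over these \<open>t\<close> against the law of \<open>\<Theta>\<close> preserves the
  factor \<open>K\<close>, and the remaining values of \<open>\<Theta>\<close> contribute at most \<open>P(\<Theta> > min x y / R)\<close>.
  By the smallness hypothesis with \<open>c = 1 / R\<close> this remainder is eventually below the joint
  tail of \<open>(\<Theta> X, \<Theta> Y)\<close>, so its ratio is eventually bounded by \<open>K + 1\<close>.

  The marginals follow the same pattern. On the diagonal \<open>x = y\<close> the smallness hypothesis
  compares \<open>P(\<Theta> > c x)\<close> with a joint tail that lies below each marginal tail, hence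
  it yields what the one-dimensional argument requires. Both arguments rest on
  \<open>prob_mixture_split\<close>, which is stated for arbitrary events depending on \<open>\<Theta>\<close> and on a
  vector independent of it. Positivity of all tails of \<open>(\<Theta> X, \<Theta> Y)\<close> comes from
  \<open>P(\<Theta> > \<epsilon>) > 0\<close> for some \<open>\<epsilon> > 0\<close>, together with independence.
\<close>

section \<open>Bounded ratios and the limit of the minimum\<close>

lemma Limsup_ereal_less_infinity_iff:
  fixes f :: "'b \<Rightarrow> real"
  shows "Limsup F (\<lambda>x. ereal (f x)) < \<infinity> \<longleftrightarrow> (\<exists>K. eventually (\<lambda>x. f x \<le> K) F)"
proof
  assume "Limsup F (\<lambda>x. ereal (f x)) < \<infinity>"
  then obtain K where "Limsup F (\<lambda>x. ereal (f x)) < ereal K"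
    using ereal_dense2 by blast
  then have "eventually (\<lambda>x. ereal (f x) < ereal K) F"
    by (rule Limsup_lessD)
  then show "\<exists>K. eventually (\<lambda>x. f x \<le> K) F"
    by (auto elim!: eventually_mono intro!: exI[of _ K])
next
  assume "\<exists>K. eventually (\<lambda>x. f x \<le> K) F"
  then obtain K where "eventually (\<lambda>x. f x \<le> K) F" by blast
  then have "Limsup F (\<lambda>x. ereal (f x)) \<le> ereal K"
    by (intro Limsup_bounded) (auto elim: eventually_mono)
  then show "Limsup F (\<lambda>x. ereal (f x)) < \<infinity>"
    by (rule le_less_trans) simp
qed

lemma ratio_boundedE:
  fixes f g :: "'b \<Rightarrow> real"
  assumes "Limsup F (\<lambda>x. ereal (f x / g x)) < \<infinity>" and "eventually (\<lambda>x. g x > 0) F"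
  obtains K where "K \<ge> 0" and "eventually (\<lambda>x. f x \<le> K * g x) F"
proof -
  obtain K where K: "eventually (\<lambda>x. f x / g x \<le> K) F"
    using assms(1) unfolding Limsup_ereal_less_infinity_iff by blast
  \<comment> \<open>A negative bound is possible, since nothing is assumed about the sign of \<open>f\<close>.\<close>
  have "eventually (\<lambda>x. f x \<le> max K 0 * g x) F"
    using K assms(2)
  proof eventually_elim
    case (elim x)
    then have "f x \<le> K * g x" by (simp add: divide_le_eq)
    also have "\<dots> \<le> max K 0 * g x" using elim by (intro mult_right_mono) auto
    finally show ?case .
  qed
  then show ?thesis using that[of "max K 0"] by simp
qed

lemma ratio_boundedI:
  fixes f g :: "'b \<Rightarrow> real"
  assumes "eventually (\<lambda>x. f x \<le> K * g x) F" and "eventually (\<lambda>x. g x > 0) F"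
  shows "Limsup F (\<lambda>x. ereal (f x / g x)) < \<infinity>"
proof -
  have "eventually (\<lambda>x. f x / g x \<le> K) F"
    using assms by eventually_elim (simp add: divide_le_eq)
  then show ?thesis
    unfolding Limsup_ereal_less_infinity_iff by blast
qed

lemma eventually_min_at_top:
  "eventually P min_at_top \<longleftrightarrow> (\<exists>R. \<forall>x\<ge>R. \<forall>y\<ge>R. P (x, y))"
proof -
  have "eventually P min_at_top \<longleftrightarrow> (\<exists>Q. (\<exists>R. \<forall>r\<ge>R. Q r) \<and> (\<forall>x y. Q (min x y) \<longrightarrow> P (x, y)))"
    by (simp add: min_at_top_def eventually_filtercomap eventually_at_top_linorder)
  also have "\<dots> \<longleftrightarrow> (\<exists>R. \<forall>x y. R \<le> min x y \<longrightarrow> P (x, y))"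
    by blast
  finally show ?thesis by auto
qed

lemma eventually_min_at_topI:
  assumes "\<And>x y. x \<ge> 0 \<Longrightarrow> y \<ge> 0 \<Longrightarrow> P (x, y)"
  shows "eventually P min_at_top"
  unfolding eventually_min_at_top using assms by blast

lemma filterlim_diagonal_min_at_top: "filterlim (\<lambda>x. (x, x)) min_at_top at_top"
  by (auto simp: filterlim_iff eventually_min_at_top eventually_at_top_linorder)

section \<open>Mixtures over an independent factor\<close>

lemma (in prob_space) tail_distr:
  assumes [measurable]: "X \<in> borel_measurable M"
  shows "tail (distr M borel X) x = prob {\<omega> \<in> space M. X \<omega> > x}"
proof -
  have "cdf (distr M borel X) x = prob {\<omega> \<in> space M. X \<omega> \<le> x}"
    by (auto simp: cdf_def measure_distr intro!: arg_cong[where f = prob])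
  also have "\<dots> = 1 - prob {\<omega> \<in> space M. X \<omega> > x}"
    by (subst prob_neg[symmetric]) (auto simp: not_less)
  finally show ?thesis by (simp add: tail_def)
qed

lemma (in prob_space) indep_of_pair_prob:
  assumes "indep_of_pair M T Z" and "A \<in> sets borel" and "C \<in> sets borel"
  shows "prob (T -` A \<inter> space M \<inter> (Z -` C \<inter> space M))
    = prob (T -` A \<inter> space M) * prob (Z -` C \<inter> space M)"
  using assms(1) unfolding indep_of_pair_def
  by (rule indep_setD) (rule in_vimage_algebra; rule assms)+

lemma (in prob_space) joint_law_indep_of_pair:
  assumes [measurable]: "T \<in> borel_measurable M" "Z \<in> borel_measurable M"
    and indep: "indep_of_pair M T Z"
  shows "distr M borel T \<Otimes>\<^sub>M distr M borel Z = distr M (borel \<Otimes>\<^sub>M borel) (\<lambda>\<omega>. (T \<omega>, Z \<omega>))"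
proof (rule pair_measure_eqI)
  show "sigma_finite_measure (distr M borel T)" "sigma_finite_measure (distr M borel Z)"
    by (intro prob_space_imp_sigma_finite prob_space_distr; measurable)+
  fix A :: "real set" and C :: "(real \<times> real) set"
  assume "A \<in> sets (distr M borel T)" "C \<in> sets (distr M borel Z)"
  then have [measurable]: "A \<in> sets borel" "C \<in> sets borel" by auto
  have "(\<lambda>\<omega>. (T \<omega>, Z \<omega>)) -` (A \<times> C) \<inter> space M
      = T -` A \<inter> space M \<inter> (Z -` C \<inter> space M)" by auto
  then show "emeasure (distr M borel T) A * emeasure (distr M borel Z) C
      = emeasure (distr M (borel \<Otimes>\<^sub>M borel) (\<lambda>\<omega>. (T \<omega>, Z \<omega>))) (A \<times> C)"
    using indep_of_pair_prob[OF indep, of A C]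
    by (simp add: emeasure_distr emeasure_eq_measure ennreal_mult)
qed (auto intro!: sets_pair_measure_cong)

text \<open>
  By Fubini, \<open>P(r (T, Z))\<close> is the integral of \<open>P(r (t, Z))\<close> over the law of \<open>T\<close>, so a
  domination of the conditional probabilities for all \<open>t\<close> in \<open>I\<close> can be integrated.
\<close>
lemma (in prob_space) prob_mixture_mono:
  fixes p q :: "real \<times> real \<times> real \<Rightarrow> bool"
  assumes meas[measurable]: "T \<in> borel_measurable M" "Z \<in> borel_measurable M"
    and indep: "indep_of_pair M T Z"
    and pq[measurable]: "Measurable.pred (borel \<Otimes>\<^sub>M borel) p" "Measurable.pred (borel \<Otimes>\<^sub>M borel) q"
    and "K \<ge> 0" and I[measurable]: "I \<in> sets borel"
    and le: "\<And>t. t \<in> I \<Longrightarrow> \<P>(\<omega> in M. p (t, Z \<omega>)) \<le> K * \<P>(\<omega> in M. q (t, Z \<omega>))"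
  shows "\<P>(\<omega> in M. T \<omega> \<in> I \<and> p (T \<omega>, Z \<omega>)) \<le> K * \<P>(\<omega> in M. q (T \<omega>, Z \<omega>))"
proof -
  define \<mu> where "\<mu> = distr M borel T"
  define \<nu> where "\<nu> = distr M borel Z"
  have [simp, measurable_cong]: "sets \<mu> = sets borel" "sets \<nu> = sets borel"
    by (simp_all add: \<mu>_def \<nu>_def)
  have [simp]: "space \<mu> = UNIV" "space \<nu> = UNIV" by (simp_all add: \<mu>_def \<nu>_def)
  have sets_prod: "sets (\<mu> \<Otimes>\<^sub>M \<nu>) = sets (borel \<Otimes>\<^sub>M borel)"
    by (intro sets_pair_measure_cong) simp_all
  interpret \<nu>: sigma_finite_measure \<nu>
    unfolding \<nu>_def by (intro prob_space_imp_sigma_finite prob_space_distr meas)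
  have fubini: "emeasure M {\<omega> \<in> space M. r (T \<omega>, Z \<omega>)}
      = (\<integral>\<^sup>+t. emeasure M {\<omega> \<in> space M. r (t, Z \<omega>)} \<partial>\<mu>)"
    and meas_section: "(\<lambda>t. emeasure M {\<omega> \<in> space M. r (t, Z \<omega>)}) \<in> borel_measurable \<mu>"
    if r[measurable]: "Measurable.pred (borel \<Otimes>\<^sub>M borel) r" for r
  proof -
    have r_set: "{w. r w} \<in> sets (borel \<Otimes>\<^sub>M borel)"
      using r by (simp add: pred_def space_pair_measure)
    have sect: "emeasure \<nu> (Pair t -` {w. r w}) = emeasure M {\<omega> \<in> space M. r (t, Z \<omega>)}" for t
    proof -
      have "Pair t -` {w. r w} \<in> sets borel"
        using sets_Pair1[OF r_set] by simp
      then show ?thesis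
        unfolding \<nu>_def
        by (subst emeasure_distr) (auto intro!: arg_cong[where f = "emeasure M"])
    qed
    have "emeasure M {\<omega> \<in> space M. r (T \<omega>, Z \<omega>)}
        = emeasure (distr M (borel \<Otimes>\<^sub>M borel) (\<lambda>\<omega>. (T \<omega>, Z \<omega>))) {w. r w}"
      using r_set by (subst emeasure_distr) (auto intro!: arg_cong[where f = "emeasure M"])
    also have "\<dots> = emeasure (\<mu> \<Otimes>\<^sub>M \<nu>) {w. r w}"
      by (simp add: \<mu>_def \<nu>_def joint_law_indep_of_pair[OF meas indep])
    also have "\<dots> = (\<integral>\<^sup>+t. emeasure \<nu> (Pair t -` {w. r w}) \<partial>\<mu>)"
      using r_set sets_prod by (intro \<nu>.emeasure_pair_measure_alt) simp
    finally show "emeasure M {\<omega> \<in> space M. r (T \<omega>, Z \<omega>)}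
      = (\<integral>\<^sup>+t. emeasure M {\<omega> \<in> space M. r (t, Z \<omega>)} \<partial>\<mu>)"
      by (simp only: sect)
    show "(\<lambda>t. emeasure M {\<omega> \<in> space M. r (t, Z \<omega>)}) \<in> borel_measurable \<mu>"
      using \<nu>.measurable_emeasure_Pair[of "{w. r w}" \<mu>] r_set sets_prod by (simp only: sect)
  qed
  \<comment> \<open>Putting the restriction to \<open>I\<close> into the event replaces integration over \<open>I\<close>.\<close>
  have p': "Measurable.pred (borel \<Otimes>\<^sub>M borel) (\<lambda>w. fst w \<in> I \<and> p w)"
    by measurable
  have "emeasure M {\<omega> \<in> space M. T \<omega> \<in> I \<and> p (T \<omega>, Z \<omega>)}
      = (\<integral>\<^sup>+t. emeasure M {\<omega> \<in> space M. t \<in> I \<and> p (t, Z \<omega>)} \<partial>\<mu>)"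
    using fubini[OF p'] by simp
  also have "\<dots> \<le> (\<integral>\<^sup>+t. ennreal K * emeasure M {\<omega> \<in> space M. q (t, Z \<omega>)} \<partial>\<mu>)"
  proof (rule nn_integral_mono)
    fix t
    show "emeasure M {\<omega> \<in> space M. t \<in> I \<and> p (t, Z \<omega>)}
        \<le> ennreal K * emeasure M {\<omega> \<in> space M. q (t, Z \<omega>)}"
      using le[of t] \<open>K \<ge> 0\<close>
      by (cases "t \<in> I") (auto simp: emeasure_eq_measure ennreal_mult[symmetric] intro!: ennreal_leI)
  qed
  also have "\<dots> = ennreal K * emeasure M {\<omega> \<in> space M. q (T \<omega>, Z \<omega>)}"
    by (subst nn_integral_cmult) (simp_all add: fubini[OF pq(2)] meas_section[OF pq(2)])
  finally show ?thesis
    using \<open>K \<ge> 0\<close> by (simp add: emeasure_eq_measure ennreal_mult[symmetric])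
qed

text \<open>
  The truncation at \<open>c\<close>: the comparison of conditional probabilities is available only for
  small values of \<open>T\<close>, and the large ones are paid for in full. The value \<open>0\<close>,
  where dividing thresholds by \<open>t\<close> makes no sense, never contributes to \<open>p\<close>.
\<close>
lemma (in prob_space) prob_mixture_split:
  fixes p q :: "real \<times> real \<times> real \<Rightarrow> bool"
  assumes meas[measurable]: "T \<in> borel_measurable M" "Z \<in> borel_measurable M"
    and indep: "indep_of_pair M T Z"
    and pq[measurable]: "Measurable.pred (borel \<Otimes>\<^sub>M borel) p" "Measurable.pred (borel \<Otimes>\<^sub>M borel) q"
    and "K \<ge> 0" and nonneg: "AE \<omega> in M. T \<omega> \<ge> 0" and not0: "\<And>z. \<not> p (0, z)"
    and le: "\<And>t. 0 < t \<Longrightarrow> t \<le> c \<Longrightarrow> \<P>(\<omega> in M. p (t, Z \<omega>)) \<le> K * \<P>(\<omega> in M. q (t, Z \<omega>))"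
  shows "\<P>(\<omega> in M. p (T \<omega>, Z \<omega>)) \<le> K * \<P>(\<omega> in M. q (T \<omega>, Z \<omega>)) + \<P>(\<omega> in M. T \<omega> > c)"
proof -
  have "\<P>(\<omega> in M. p (T \<omega>, Z \<omega>))
      \<le> prob ({\<omega> \<in> space M. T \<omega> \<in> {0<..c} \<and> p (T \<omega>, Z \<omega>)} \<union> {\<omega> \<in> space M. T \<omega> > c})"
  proof (rule finite_measure_mono_AE)
    show "AE \<omega> in M. \<omega> \<in> {\<omega> \<in> space M. p (T \<omega>, Z \<omega>)} \<longrightarrow>
        \<omega> \<in> {\<omega> \<in> space M. T \<omega> \<in> {0<..c} \<and> p (T \<omega>, Z \<omega>)} \<union> {\<omega> \<in> space M. T \<omega> > c}"
      using nonneg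
    proof eventually_elim
      case (elim \<omega>)
      then show ?case using not0[of "Z \<omega>"] by (cases "T \<omega> = 0") auto
    qed
  qed measurable
  also have "\<dots> \<le> \<P>(\<omega> in M. T \<omega> \<in> {0<..c} \<and> p (T \<omega>, Z \<omega>)) + \<P>(\<omega> in M. T \<omega> > c)"
    by (rule measure_Un_le) measurable
  also have "\<P>(\<omega> in M. T \<omega> \<in> {0<..c} \<and> p (T \<omega>, Z \<omega>)) \<le> K * \<P>(\<omega> in M. q (T \<omega>, Z \<omega>))"
    by (rule prob_mixture_mono[OF meas indep pq \<open>K \<ge> 0\<close>]) (auto intro: le)
  finally show ?thesis by simp
qed

section \<open>Sign and positivity of the random factor\<close>

lemma (in prob_space) AE_nonneg_of_cdf_at_left:
  assumes [measurable]: "T \<in> borel_measurable M"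
    and "(cdf (distr M borel T) \<longlongrightarrow> 0) (at_left 0)"
  shows "AE \<omega> in M. T \<omega> \<ge> 0"
proof -
  have D: "finite_borel_measure (distr M borel T)"
    by (intro real_distribution.finite_borel_measure_M real_distribution_distr assms(1))
  have "measure (distr M borel T) {..<0} = 0"
    by (rule tendsto_unique[OF _ finite_borel_measure.cdf_at_left[OF D] assms(2)]) simp
  moreover have "T -` {..<0} \<inter> space M = {\<omega> \<in> space M. T \<omega> < 0}"
    by auto
  ultimately have "prob {\<omega> \<in> space M. T \<omega> < 0} = 0"
    by (simp add: measure_distr)
  then show ?thesis
    by (subst (asm) prob_eq_0) (auto simp: not_less)
qed

text \<open>Right-continuity of the distribution function moves the point \<open>a\<close> strictly to the right.\<close>
lemma (in prob_space) prob_gt_pos_of_cdf_less_1: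
  assumes "T \<in> borel_measurable M" and "cdf (distr M borel T) a < 1"
  obtains \<epsilon> where "\<epsilon> > a" and "\<P>(\<omega> in M. T \<omega> > \<epsilon>) > 0"
proof -
  have D: "finite_borel_measure (distr M borel T)"
    by (intro real_distribution.finite_borel_measure_M real_distribution_distr assms(1))
  have "(cdf (distr M borel T) \<longlongrightarrow> cdf (distr M borel T) a) (at_right a)"
    using finite_borel_measure.cdf_is_right_cont[OF D, of a] by (simp add: continuous_within)
  then have "eventually (\<lambda>t. cdf (distr M borel T) t < 1) (at_right a)"
    using assms(2) by (rule order_tendstoD)
  then have "eventually (\<lambda>t. t > a \<and> cdf (distr M borel T) t < 1) (at_right a)"
    using eventually_at_right_less[of a] by eventually_elim auto
  then obtain t where "t > a" "cdf (distr M borel T) t < 1"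
    using eventually_happens'[OF trivial_limit_at_right_real] by blast
  then show ?thesis
    using that[of t] tail_distr[OF assms(1), of t] by (simp add: tail_def)
qed

section \<open>Tails of the scaled vector\<close>

lemma less_mult_of_divide_less:
  fixes t e u v :: real
  assumes "0 < e" "e < t" "0 \<le> u" "u / e < v"
  shows "u < t * v"
proof -
  have "0 \<le> u / e" using assms(1,3) by simp
  then have "0 < v" using assms(4) by linarith
  have "u < e * v" using assms(1,4) by (simp add: pos_divide_less_eq mult.commute)
  also have "\<dots> < t * v" using assms(2) \<open>0 < v\<close> by (rule mult_strict_right_mono)
  finally show ?thesis .
qed

text \<open>
  Since \<open>T\<close> exceeds some \<open>\<epsilon> > 0\<close> with positive probability, the scaled vector passes
  \<open>(x, y)\<close> at least on the intersection of this event with the independent event that \<open>(X, Y)\<close>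
  passes \<open>(x / \<epsilon>, y / \<epsilon>)\<close>.
\<close>
lemma (in prob_space) joint_tail_scaled_pos:
  assumes meas[measurable]: "T \<in> borel_measurable M" "X \<in> borel_measurable M" "Y \<in> borel_measurable M"
    and indep: "indep_of_pair M T (\<lambda>\<omega>. (X \<omega>, Y \<omega>))"
    and cdf: "cdf (distr M borel T) 0 < 1"
    and pos: "\<And>x y. x \<ge> 0 \<Longrightarrow> y \<ge> 0 \<Longrightarrow> joint_tail M X Y x y > 0"
    and xy: "x \<ge> 0" "y \<ge> 0"
  shows "joint_tail M (\<lambda>\<omega>. T \<omega> * X \<omega>) (\<lambda>\<omega>. T \<omega> * Y \<omega>) x y > 0"
proof -
  obtain \<epsilon> where "\<epsilon> > 0" and \<epsilon>: "\<P>(\<omega> in M. T \<omega> > \<epsilon>) > 0"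
    using prob_gt_pos_of_cdf_less_1[OF meas(1) cdf] .
  let ?A = "T -` {\<epsilon><..} \<inter> space M"
    and ?C = "(\<lambda>\<omega>. (X \<omega>, Y \<omega>)) -` ({x / \<epsilon><..} \<times> {y / \<epsilon><..}) \<inter> space M"
  have A: "?A = {\<omega> \<in> space M. T \<omega> > \<epsilon>}"
    and C: "?C = {\<omega> \<in> space M. X \<omega> > x / \<epsilon> \<and> Y \<omega> > y / \<epsilon>}"
    by auto
  have "prob ?C > 0"
    using pos[of "x / \<epsilon>" "y / \<epsilon>"] xy \<open>\<epsilon> > 0\<close> unfolding C joint_tail_def by simp
  then have "0 < prob ?A * prob ?C"
    using \<epsilon> unfolding A by simp
  also have "\<dots> = prob (?A \<inter> ?C)"
    by (rule indep_of_pair_prob[OF indep, symmetric]) (auto intro!: borel_open open_Times)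
  also have "\<dots> \<le> joint_tail M (\<lambda>\<omega>. T \<omega> * X \<omega>) (\<lambda>\<omega>. T \<omega> * Y \<omega>) x y"
    unfolding joint_tail_def A C
    using less_mult_of_divide_less[OF \<open>\<epsilon> > 0\<close>] xy
    by (intro finite_measure_mono) auto
  finally show ?thesis .
qed

lemma le_divide_of_le_divide:
  fixes t m R u :: real
  assumes "0 < t" "0 < R" "t \<le> m / R" "m \<le> u"
  shows "R \<le> u / t"
proof -
  have "R * t \<le> u" using assms by (simp add: pos_le_divide_eq mult.commute)
  then show ?thesis using assms(1) by (simp add: pos_le_divide_eq)
qed

text \<open>
  The choice \<open>c = min x y / R\<close> in the truncation is the largest for which both thresholds
  \<open>x / t\<close> and \<open>y / t\<close> stay in the range \<open>[R, \<infinity>)\<close> of the assumed comparison.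
\<close>
lemma (in prob_space) joint_tail_scaled_bound:
  assumes meas[measurable]: "T \<in> borel_measurable M" "X \<in> borel_measurable M" "Y \<in> borel_measurable M"
    and indep: "indep_of_pair M T (\<lambda>\<omega>. (X \<omega>, Y \<omega>))"
    and nonneg: "AE \<omega> in M. T \<omega> \<ge> 0"
    and "K \<ge> 0" "R > 0" "b1 > 0" "b2 > 0"
    and le: "\<And>x y. x \<ge> R \<Longrightarrow> y \<ge> R \<Longrightarrow>
      joint_tail M X Y (b1 * x) (b2 * y) \<le> K * joint_tail M X Y x y"
    and xy: "x \<ge> 0" "y \<ge> 0"
  shows "joint_tail M (\<lambda>\<omega>. T \<omega> * X \<omega>) (\<lambda>\<omega>. T \<omega> * Y \<omega>) (b1 * x) (b2 * y)
    \<le> K * joint_tail M (\<lambda>\<omega>. T \<omega> * X \<omega>) (\<lambda>\<omega>. T \<omega> * Y \<omega>) x y + \<P>(\<omega> in M. T \<omega> > min x y / R)"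
proof -
  define p :: "real \<times> real \<times> real \<Rightarrow> bool"
    where "p w \<longleftrightarrow> fst w * fst (snd w) > b1 * x \<and> fst w * snd (snd w) > b2 * y" for w
  define q :: "real \<times> real \<times> real \<Rightarrow> bool"
    where "q w \<longleftrightarrow> fst w * fst (snd w) > x \<and> fst w * snd (snd w) > y" for w
  have "\<P>(\<omega> in M. p (T \<omega>, X \<omega>, Y \<omega>))
      \<le> K * \<P>(\<omega> in M. q (T \<omega>, X \<omega>, Y \<omega>)) + \<P>(\<omega> in M. T \<omega> > min x y / R)"
  proof (rule prob_mixture_split[OF meas(1) _ indep _ _ \<open>K \<ge> 0\<close> nonneg])
    show "(\<lambda>\<omega>. (X \<omega>, Y \<omega>)) \<in> borel_measurable M" by measurable
    show "Measurable.pred (borel \<Otimes>\<^sub>M borel) p" "Measurable.pred (borel \<Otimes>\<^sub>M borel) q"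
      unfolding p_def q_def borel_prod[symmetric] by measurable
    show "\<not> p (0, z)" for z
      using xy \<open>b1 > 0\<close> by (simp add: p_def not_less)
    fix t :: real assume "0 < t" "t \<le> min x y / R"
    then have "R \<le> x / t" "R \<le> y / t"
      using le_divide_of_le_divide \<open>R > 0\<close> by (meson min.cobounded1 min.cobounded2)+
    from le[OF this] show "\<P>(\<omega> in M. p (t, X \<omega>, Y \<omega>)) \<le> K * \<P>(\<omega> in M. q (t, X \<omega>, Y \<omega>))"
      using \<open>0 < t\<close> by (simp add: p_def q_def joint_tail_def pos_divide_less_eq mult.commute)
  qed
  then show ?thesis by (simp add: p_def q_def joint_tail_def)
qed

text \<open>
  The one-dimensional closure property. The variable being scaled is a function \<open>f\<close> of the
  vector \<open>Z\<close>, so that both coordinates of a random pair are covered by the independence of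
  \<open>T\<close> from the whole pair.
\<close>
lemma (in prob_space) dominatedly_varying_scaled:
  fixes f :: "real \<times> real \<Rightarrow> real"
  assumes meas[measurable]: "T \<in> borel_measurable M" "Z \<in> borel_measurable M" "f \<in> borel_measurable borel"
    and indep: "indep_of_pair M T Z"
    and nonneg: "AE \<omega> in M. T \<omega> \<ge> 0"
    and dv: "dominatedly_varying (distr M borel (\<lambda>\<omega>. f (Z \<omega>)))"
    and pos: "\<And>x. x \<ge> 0 \<Longrightarrow> \<P>(\<omega> in M. T \<omega> * f (Z \<omega>) > x) > 0"
    and small: "\<And>c. c > 0 \<Longrightarrow>
      eventually (\<lambda>x. \<P>(\<omega> in M. T \<omega> > c * x) \<le> \<P>(\<omega> in M. T \<omega> * f (Z \<omega>) > x)) at_top"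
  shows "dominatedly_varying (distr M borel (\<lambda>\<omega>. T \<omega> * f (Z \<omega>)))"
proof -
  define g where "g x = \<P>(\<omega> in M. f (Z \<omega>) > x)" for x
  define h where "h x = \<P>(\<omega> in M. T \<omega> * f (Z \<omega>) > x)" for x
  have tails: "tail (distr M borel (\<lambda>\<omega>. f (Z \<omega>))) x = g x"
    "tail (distr M borel (\<lambda>\<omega>. T \<omega> * f (Z \<omega>))) x = h x" for x
    unfolding g_def h_def by (rule tail_distr; measurable)+
  have h_pos: "h x > 0" if "x \<ge> 0" for x
    using pos[OF that] by (simp add: h_def)
  have g_pos: "g x > 0" if "x \<ge> 0" for x
    using dv that by (simp add: dominatedly_varying_def tails)
  obtain b where b: "b \<in> {0<..<1}" and Limsup_g: "Limsup at_top (\<lambda>x. ereal (g (b * x) / g x)) < \<infinity>"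
    using dv unfolding dominatedly_varying_def tails by blast
  have "eventually (\<lambda>x. g x > 0) at_top"
    using eventually_ge_at_top[of 0] by eventually_elim (rule g_pos)
  with Limsup_g obtain K where "K \<ge> 0" and "eventually (\<lambda>x. g (b * x) \<le> K * g x) at_top"
    by (rule ratio_boundedE)
  then obtain R0 where R0: "\<And>x. x \<ge> R0 \<Longrightarrow> g (b * x) \<le> K * g x"
    unfolding eventually_at_top_linorder by blast
  \<comment> \<open>The threshold is raised to be positive, since the truncation level is \<open>x / R\<close>.\<close>
  define R where "R = max R0 1"
  have R: "R > 0" "R \<ge> R0" by (auto simp: R_def)
  have bound: "h (b * x) \<le> K * h x + \<P>(\<omega> in M. T \<omega> > x / R)" if "x \<ge> 0" for x
  proof -
    define p where "p w \<longleftrightarrow> fst w * f (snd w) > b * x" for w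
    define q where "q w \<longleftrightarrow> fst w * f (snd w) > x" for w
    have "\<P>(\<omega> in M. p (T \<omega>, Z \<omega>)) \<le> K * \<P>(\<omega> in M. q (T \<omega>, Z \<omega>)) + \<P>(\<omega> in M. T \<omega> > x / R)"
    proof (rule prob_mixture_split[OF meas(1,2) indep _ _ \<open>K \<ge> 0\<close> nonneg])
      show "Measurable.pred (borel \<Otimes>\<^sub>M borel) p" "Measurable.pred (borel \<Otimes>\<^sub>M borel) q"
        unfolding p_def q_def by measurable
      show "\<not> p (0, z)" for z
        using b that by (simp add: p_def not_less)
      fix t :: real assume "0 < t" "t \<le> x / R"
      then have "R0 \<le> x / t"
        using le_divide_of_le_divide[of t R x x] R by simp
      from R0[OF this] show "\<P>(\<omega> in M. p (t, Z \<omega>)) \<le> K * \<P>(\<omega> in M. q (t, Z \<omega>))"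
        using \<open>0 < t\<close> by (simp add: p_def q_def g_def pos_divide_less_eq mult.commute)
    qed
    then show ?thesis by (simp add: p_def q_def h_def)
  qed
  have "eventually (\<lambda>x. \<P>(\<omega> in M. T \<omega> > x / R) \<le> h x) at_top"
    using small[of "1 / R"] R by (simp add: h_def)
  then have "eventually (\<lambda>x. h (b * x) \<le> (K + 1) * h x) at_top"
    using eventually_ge_at_top[of 0]
  proof eventually_elim
    case (elim x)
    then show ?case using bound[of x] by (simp add: algebra_simps)
  qed
  moreover have "eventually (\<lambda>x. h x > 0) at_top"
    using eventually_ge_at_top[of 0] by eventually_elim (rule h_pos)
  ultimately have "Limsup at_top (\<lambda>x. ereal (h (b * x) / h x)) < \<infinity>"
    by (rule ratio_boundedI)
  then show ?thesis
    unfolding dominatedly_varying_def tails using b h_pos by blast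
qed

theorem theorem5p1:
  fixes M :: "'a measure" and X Y \<Theta> :: "'a \<Rightarrow> real" and B :: "real measure"
  assumes "prob_space M"
    and "X \<in> borel_measurable M" and "Y \<in> borel_measurable M" and "\<Theta> \<in> borel_measurable M"
    and "B = distr M borel \<Theta>"
    and "(cdf B \<longlongrightarrow> 0) (at_left 0)" and "cdf B 0 < 1"
    and "indep_of_pair M \<Theta> (\<lambda>\<omega>. (X \<omega>, Y \<omega>))"
    and "\<And>c. c > 0 \<Longrightarrow>
      (\<lambda>(x, y). \<P>(\<omega> in M. \<Theta> \<omega> > c * min x y)) \<in>
        o[min_at_top](\<lambda>(x, y). \<P>(\<omega> in M. \<Theta> \<omega> * X \<omega> > x \<and> \<Theta> \<omega> * Y \<omega> > y))"
    and "jointly_dominatedly_varying M X Y"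
  shows "jointly_dominatedly_varying M (\<lambda>\<omega>. \<Theta> \<omega> * X \<omega>) (\<lambda>\<omega>. \<Theta> \<omega> * Y \<omega>)"
proof -
  interpret prob_space M by fact
  note meas[measurable] = assms(4,2,3)
  have Z[measurable]: "(\<lambda>\<omega>. (X \<omega>, Y \<omega>)) \<in> borel_measurable M" by measurable
  define J where "J = joint_tail M X Y"
  define H where "H = joint_tail M (\<lambda>\<omega>. \<Theta> \<omega> * X \<omega>) (\<lambda>\<omega>. \<Theta> \<omega> * Y \<omega>)"
  have nonneg: "AE \<omega> in M. \<Theta> \<omega> \<ge> 0"
    using AE_nonneg_of_cdf_at_left[OF meas(1)] assms(5,6) by simp
  have dvX: "dominatedly_varying (distr M borel X)" and dvY: "dominatedly_varying (distr M borel Y)"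
    and J_pos: "\<And>x y. x \<ge> 0 \<Longrightarrow> y \<ge> 0 \<Longrightarrow> J x y > 0"
    using assms(10) unfolding jointly_dominatedly_varying_def J_def by blast+
  obtain b1 b2 where b: "b1 \<in> {0<..<1}" "b2 \<in> {0<..<1}"
    and Limsup_J: "Limsup min_at_top (\<lambda>(x, y). ereal (J (b1 * x) (b2 * y) / J x y)) < \<infinity>"
    using assms(10) unfolding jointly_dominatedly_varying_def J_def by blast
  have H_pos: "H x y > 0" if "x \<ge> 0" "y \<ge> 0" for x y
    unfolding H_def using assms(5,7) J_pos that
    by (intro joint_tail_scaled_pos meas assms(8)) (simp_all add: J_def)
  have small: "eventually (\<lambda>w. \<P>(\<omega> in M. \<Theta> \<omega> > c * min (fst w) (snd w)) \<le> H (fst w) (snd w)) min_at_top"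
    if "c > 0" for c
    using landau_o.smallD[OF assms(9)[OF that], of 1]
    by (simp add: case_prod_unfold H_def joint_tail_def)

  have joint: "Limsup min_at_top (\<lambda>(x, y). ereal (H (b1 * x) (b2 * y) / H x y)) < \<infinity>"
  proof -
    have "Limsup min_at_top (\<lambda>w. ereal (J (b1 * fst w) (b2 * snd w) / J (fst w) (snd w))) < \<infinity>"
      using Limsup_J by (simp add: case_prod_unfold)
    moreover have "eventually (\<lambda>w. J (fst w) (snd w) > 0) min_at_top"
      by (rule eventually_min_at_topI) (simp add: J_pos)
    ultimately obtain K where "K \<ge> 0"
      and "eventually (\<lambda>w. J (b1 * fst w) (b2 * snd w) \<le> K * J (fst w) (snd w)) min_at_top"
      by (rule ratio_boundedE)
    then obtain R0 where R0: "\<And>x y. x \<ge> R0 \<Longrightarrow> y \<ge> R0 \<Longrightarrow> J (b1 * x) (b2 * y) \<le> K * J x y"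
      unfolding eventually_min_at_top by auto
    define R where "R = max R0 1"
    have "R > 0" by (simp add: R_def)
    have bound: "H (b1 * x) (b2 * y) \<le> K * H x y + \<P>(\<omega> in M. \<Theta> \<omega> > min x y / R)"
      if "x \<ge> 0" "y \<ge> 0" for x y
      unfolding H_def
    proof (rule joint_tail_scaled_bound[OF meas assms(8) nonneg \<open>K \<ge> 0\<close> \<open>R > 0\<close>])
      show "joint_tail M X Y (b1 * x) (b2 * y) \<le> K * joint_tail M X Y x y" if "x \<ge> R" "y \<ge> R" for x y
        using R0[of x y] that by (simp add: R_def J_def)
    qed (use b that in simp_all)
    have "eventually (\<lambda>w. fst w \<ge> 0 \<and> snd w \<ge> 0) min_at_top"
      by (rule eventually_min_at_topI) simp
    moreover have "eventually (\<lambda>w. \<P>(\<omega> in M. \<Theta> \<omega> > min (fst w) (snd w) / R) \<le> H (fst w) (snd w)) min_at_top"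
      using small[of "1 / R"] \<open>R > 0\<close> by simp
    ultimately have "eventually (\<lambda>w. H (b1 * fst w) (b2 * snd w) \<le> (K + 1) * H (fst w) (snd w)) min_at_top"
    proof eventually_elim
      case (elim w)
      then show ?case using bound[of "fst w" "snd w"] by (simp add: algebra_simps)
    qed
    moreover have "eventually (\<lambda>w. H (fst w) (snd w) > 0) min_at_top"
      by (rule eventually_min_at_topI) (simp add: H_pos)
    ultimately have "Limsup min_at_top (\<lambda>w. ereal (H (b1 * fst w) (b2 * snd w) / H (fst w) (snd w))) < \<infinity>"
      by (rule ratio_boundedI)
    then show ?thesis by (simp add: case_prod_unfold)
  qed

  \<comment> \<open>To be used with \<open>f = fst\<close> and \<open>f = snd\<close>.\<close>
  have marginal: "dominatedly_varying (distr M borel (\<lambda>\<omega>. \<Theta> \<omega> * f (X \<omega>, Y \<omega>)))"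
    if f: "f \<in> borel_measurable borel"
      and dv: "dominatedly_varying (distr M borel (\<lambda>\<omega>. f (X \<omega>, Y \<omega>)))"
      and H_le: "\<And>x. H x x \<le> \<P>(\<omega> in M. \<Theta> \<omega> * f (X \<omega>, Y \<omega>) > x)" for f :: "real \<times> real \<Rightarrow> real"
  proof (rule dominatedly_varying_scaled[OF meas(1) Z f assms(8) nonneg dv])
    show "\<P>(\<omega> in M. \<Theta> \<omega> * f (X \<omega>, Y \<omega>) > x) > 0" if "x \<ge> 0" for x
      using H_pos[OF that that] H_le[of x] by linarith
    show "eventually (\<lambda>x. \<P>(\<omega> in M. \<Theta> \<omega> > c * x) \<le> \<P>(\<omega> in M. \<Theta> \<omega> * f (X \<omega>, Y \<omega>) > x)) at_top"
      if "c > 0" for c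
    proof -
      have "eventually (\<lambda>x. \<P>(\<omega> in M. \<Theta> \<omega> > c * x) \<le> H x x) at_top"
        using eventually_compose_filterlim[OF small[OF that] filterlim_diagonal_min_at_top] by simp
      then show ?thesis
        by eventually_elim (rule order_trans[OF _ H_le])
    qed
  qed
  have "dominatedly_varying (distr M borel (\<lambda>\<omega>. \<Theta> \<omega> * X \<omega>))"
    using marginal[of fst] dvX borel_measurable_continuous_onI[OF continuous_on_fst[OF continuous_on_id]]
    by (simp add: H_def joint_tail_def finite_measure_mono subset_eq)
  moreover have "dominatedly_varying (distr M borel (\<lambda>\<omega>. \<Theta> \<omega> * Y \<omega>))"
    using marginal[of snd] dvY borel_measurable_continuous_onI[OF continuous_on_snd[OF continuous_on_id]]
    by (simp add: H_def joint_tail_def finite_measure_mono subset_eq)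
  ultimately show ?thesis
    using H_pos joint b unfolding jointly_dominatedly_varying_def H_def by blast
qed

end
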